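(* Let $(\underline P,\overline P)$ be a Vertical Barrier Model on $\mathcal A(\mathbb P)$ built from a probability $P_0$ and parameters $a,b,c$, with $b<1$. Let $A\in\mathcal A(\mathbb P)$ be such that $\underline P(A),\overline P(A)\in\,]0,1[$, and let $\mathcal B\subset\mathcal A(\mathbb P)\setminus\{\emptyset\}$ be a partition such that, for all $B\in\mathcal B$, $\underline P(B)>0$, $P_0(B)<1$ and $\underline E(A|B),\overline E(A|B)\in\,]0,1[$. Then $$\Delta(A,B)=(\overline E(A|B)-\underline E(A|B))-(\overline P(A)-\underline P(A))>0,\qquad\forall B\in\mathcal B.$$
   Context: Let $\mathbb P$ be a partition (finite or infinite) of the sure event $\Omega$ and $\mathcal A(\mathbb P)$ the set of events logically dependent on $\mathbb P$, i.e. (identifying events with sets) the power set of $\mathbb P$, with $\Omega$ the whole set, $\emptyset$ the impossible event, $\wedge,{}^{\mathsf c}$ intersection and complement. A partition $\mathcal B\subset\mathcal A(\mathbb P)\setminus\{\emptyset\}$ is a family of pairwise disjoint non-empty events whose union is $\Omega$. "Probability" means finitely additive probability on $\mathcal A(\mathbb P)$. Vertical Barrier Model (VBM): given a probability $P_0$ on $\mathcal A(\mathbb P)$ and $b>0$, $a\le 0$ with $0\le a+b\le 1$, and $c=1-(a+b)$, put $\underline P(A)=\max\{bP_0(A)+a,0\}$ for $A\ne\Omega$, $\underline P(\Omega)=1$; $\overline P(A)=\min\{bP_0(A)+c,1\}$ for $A\ne\emptyset$, $\overline P(\emptyset)=0$. Natural extension: let $\mathcal M=\{P \text{ probability on }\mathcal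 A(\mathbb P): P\ge\underline P\}$. For $B\ne\emptyset$, let $\mathcal M_B$ be the set of pairs $(P,P(\cdot|B))$ with $P\in\mathcal M$ and $P(\cdot|B)$ a probability on $\mathcal A(\mathbb P)$ satisfying $P(B|B)=1$ and $P(A\wedge B)=P(A|B)P(B)$ for all $A\in\mathcal A(\mathbb P)$. Then $\underline E(A|B)=\inf_{\mathcal M_B}P(A|B)$ and $\overline E(A|B)=\sup_{\mathcal M_B}P(A|B)$. *)

theory Defs
  imports "HOL-Analysis.Analysis"
begin

text \<open>
  The atoms of the partition are the elements of a set \<open>\<Omega>\<close> of arbitrary cardinality; an event is a
  subset of \<open>\<Omega>\<close>, and the set of events logically dependent on the partition is \<^term>\<open>Pow \<Omega>\<close>.
  Set functions are total on the type; only their values on \<^term>\<open>Pow \<Omega>\<close> matter.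
\<close>

definition finadd_prob :: "'a set \<Rightarrow> ('a set \<Rightarrow> real) \<Rightarrow> bool" where
  "finadd_prob \<Omega> P \<longleftrightarrow> (\<forall>A\<in>Pow \<Omega>. 0 \<le> P A) \<and> P \<Omega> = 1 \<and> additive (Pow \<Omega>) P"

definition vertical_barrier_model ::
  "'a set \<Rightarrow> ('a set \<Rightarrow> real) \<Rightarrow> real \<Rightarrow> real \<Rightarrow> real \<Rightarrow> ('a set \<Rightarrow> real) \<Rightarrow> ('a set \<Rightarrow> real) \<Rightarrow> bool" where
  "vertical_barrier_model \<Omega> P0 a b c lP uP \<longleftrightarrow>
     finadd_prob \<Omega> P0 \<and> 0 < b \<and> a \<le> 0 \<and> 0 \<le> a + b \<and> a + b \<le> 1 \<and> c = 1 - (a + b) \<and>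
     (\<forall>A\<in>Pow \<Omega>. lP A = (if A = \<Omega> then 1 else max (b * P0 A + a) 0)) \<and>
     (\<forall>A\<in>Pow \<Omega>. uP A = (if A = {} then 0 else min (b * P0 A + c) 1))"

definition dominating_probs :: "'a set \<Rightarrow> ('a set \<Rightarrow> real) \<Rightarrow> ('a set \<Rightarrow> real) set" where
  "dominating_probs \<Omega> lP = {P. finadd_prob \<Omega> P \<and> (\<forall>A\<in>Pow \<Omega>. lP A \<le> P A)}"

text \<open>
  In a pair \<open>(P, Q)\<close> below, \<open>Q\<close> is the conditional probability given \<open>B\<close>; when \<^prop>\<open>P B = 0\<close> it is
  any finitely additive probability with \<^prop>\<open>Q B = 1\<close>.
\<close>

definition conditional_pairs ::
  "'a set \<Rightarrow> ('a set \<Rightarrow> real) \<Rightarrow> 'a set \<Rightarrow> (('a set \<Rightarrow> real) \<times> ('a set \<Rightarrow> real)) set" where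
  "conditional_pairs \<Omega> lP B =
     {(P, Q). P \<in> dominating_probs \<Omega> lP \<and> finadd_prob \<Omega> Q \<and> Q B = 1 \<and>
              (\<forall>A\<in>Pow \<Omega>. P (A \<inter> B) = Q A * P B)}"

definition lower_natural_ext :: "'a set \<Rightarrow> ('a set \<Rightarrow> real) \<Rightarrow> 'a set \<Rightarrow> 'a set \<Rightarrow> real" where
  "lower_natural_ext \<Omega> lP A B = (INF (P, Q)\<in>conditional_pairs \<Omega> lP B. Q A)"

definition upper_natural_ext :: "'a set \<Rightarrow> ('a set \<Rightarrow> real) \<Rightarrow> 'a set \<Rightarrow> 'a set \<Rightarrow> real" where
  "upper_natural_ext \<Omega> lP A B = (SUP (P, Q)\<in>conditional_pairs \<Omega> lP B. Q A)"

definition imprecision_gain ::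
  "'a set \<Rightarrow> ('a set \<Rightarrow> real) \<Rightarrow> ('a set \<Rightarrow> real) \<Rightarrow> 'a set \<Rightarrow> 'a set \<Rightarrow> real" where
  "imprecision_gain \<Omega> lP uP A B =
     (upper_natural_ext \<Omega> lP A B - lower_natural_ext \<Omega> lP A B) - (uP A - lP A)"

end

theory Submission
  imports Defs
begin

text \<open>
  With \<open>D = b P0(B) + 1 - b < 1\<close>, the values
  \<open>(b P0(A \<inter> B) + a) / D\<close> and \<open>(b P0(A \<inter> B) + c) / D\<close> are attained as conditional
  probabilities of \<open>A\<close> given \<open>B\<close> by dominating probabilities of the form \<open>b P0 - R + c \<delta>\<^sub>y\<close>, where
  \<open>R \<le> b P0\<close> is a finitely additive measure of total mass \<open>-a\<close>. Hence the conditional imprecision is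
  at least \<open>(c - a) / D > c - a\<close>, and \<open>c - a\<close> is the unconditional imprecision. If
  \<open>b P0(A \<inter> B) + a \<le> 0\<close>, then \<open>R\<close> can be chosen to cancel \<open>b P0\<close> on \<open>A \<inter> B\<close>, which forces the lower
  extension to vanish; this is excluded by hypothesis.
\<close>

section \<open>Finitely additive probabilities\<close>

lemma finadd_probD:
  assumes "finadd_prob \<Omega> P"
  shows finadd_prob_nonneg: "E \<subseteq> \<Omega> \<Longrightarrow> 0 \<le> P E"
    and finadd_prob_space: "P \<Omega> = 1"
    and finadd_prob_Un: "E \<subseteq> \<Omega> \<Longrightarrow> F \<subseteq> \<Omega> \<Longrightarrow> E \<inter> F = {} \<Longrightarrow> P (E \<union> F) = P E + P F"
  using assms by (auto simp: finadd_prob_def additive_def)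

lemma finadd_prob_split:
  assumes "finadd_prob \<Omega> P" "E \<subseteq> \<Omega>"
  shows "P E = P (E \<inter> F) + P (E - F)"
proof -
  have "P ((E \<inter> F) \<union> (E - F)) = P (E \<inter> F) + P (E - F)"
    using assms(2) by (intro finadd_prob_Un[OF assms(1)]) auto
  then show ?thesis
    by (simp add: Int_Diff_Un)
qed

lemma finadd_prob_mono:
  assumes "finadd_prob \<Omega> P" "E \<subseteq> F" "F \<subseteq> \<Omega>"
  shows "P E \<le> P F"
  using finadd_prob_split[OF assms(1,3), of E] finadd_prob_nonneg[OF assms(1), of "F - E"] assms
  by (auto simp: Int_absorb1)

lemma finadd_prob_empty:
  assumes "finadd_prob \<Omega> P"
  shows "P {} = 0"
  using finadd_prob_Un[OF assms, of "{}" "{}"] by simp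

lemma finadd_prob_Compl:
  assumes "finadd_prob \<Omega> P" "E \<subseteq> \<Omega>"
  shows "P (\<Omega> - E) = 1 - P E"
  using finadd_prob_split[OF assms(1) order_refl, of E] finadd_prob_space[OF assms(1)] assms(2)
  by (simp add: Int_absorb1)

lemma finadd_prob_le_1:
  assumes "finadd_prob \<Omega> P" "E \<subseteq> \<Omega>"
  shows "P E \<le> 1"
  using finadd_prob_mono[OF assms(1,2) order_refl] finadd_prob_space[OF assms(1)] by simp

lemma additive_restrict_prob:
  assumes "finadd_prob \<Omega> P"
  shows "additive (Pow \<Omega>) (\<lambda>E. P (E \<inter> F))"
  unfolding additive_def
proof (intro ballI impI)
  fix E G assume "E \<in> Pow \<Omega>" "G \<in> Pow \<Omega>" "E \<inter> G = {}"
  then have "P ((E \<inter> F) \<union> (G \<inter> F)) = P (E \<inter> F) + P (G \<inter> F)"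
    by (intro finadd_prob_Un[OF assms]) auto
  then show "P ((E \<union> G) \<inter> F) = P (E \<inter> F) + P (G \<inter> F)"
    by (simp add: Int_Un_distrib2)
qed

section \<open>Natural extensions\<close>

lemma conditional_prob_in_conditional_pairs:
  assumes P: "P \<in> dominating_probs \<Omega> lP" and B: "B \<subseteq> \<Omega>" "0 < P B"
  shows "(P, \<lambda>E. P (E \<inter> B) / P B) \<in> conditional_pairs \<Omega> lP B"
proof -
  have fin: "finadd_prob \<Omega> P"
    using P by (simp add: dominating_probs_def)
  have "finadd_prob \<Omega> (\<lambda>E. P (E \<inter> B) / P B)"
    unfolding finadd_prob_def
  proof (intro conjI ballI)
    fix E assume "E \<in> Pow \<Omega>"
    then have "0 \<le> P (E \<inter> B)"
      by (intro finadd_prob_nonneg[OF fin]) auto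
    then show "0 \<le> P (E \<inter> B) / P B"
      using B by simp
  next
    show "P (\<Omega> \<inter> B) / P B = 1"
      using B by (simp add: Int_absorb1)
  next
    show "additive (Pow \<Omega>) (\<lambda>E. P (E \<inter> B) / P B)"
      using additive_restrict_prob[OF fin, of B] by (simp add: additive_def add_divide_distrib)
  qed
  then show ?thesis
    using P B by (auto simp: conditional_pairs_def)
qed

lemma conditional_pairs_prob:
  assumes "(P, Q) \<in> conditional_pairs \<Omega> lP B"
  shows "finadd_prob \<Omega> Q" and "Q B = 1"
  using assms by (auto simp: conditional_pairs_def)

lemma lower_natural_ext_lower:
  assumes "(P, Q) \<in> conditional_pairs \<Omega> lP B" "A \<subseteq> \<Omega>"
  shows "lower_natural_ext \<Omega> lP A B \<le> Q A"
proof -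
  \<comment> \<open>Real infima are informative only for bounded nonempty families; conditional
    probabilities stay above 0.\<close>
  have "bdd_below ((\<lambda>(P, Q). Q A) ` conditional_pairs \<Omega> lP B)"
    using assms(2) by (intro bdd_belowI[of _ 0])
      (auto intro: finadd_prob_nonneg dest: conditional_pairs_prob)
  from cINF_lower[OF this assms(1)] show ?thesis
    by (simp add: lower_natural_ext_def)
qed

lemma upper_natural_ext_upper:
  assumes "(P, Q) \<in> conditional_pairs \<Omega> lP B" "A \<subseteq> \<Omega>"
  shows "Q A \<le> upper_natural_ext \<Omega> lP A B"
proof -
  have "bdd_above ((\<lambda>(P, Q). Q A) ` conditional_pairs \<Omega> lP B)"
    using assms(2) by (intro bdd_aboveI[of _ 1])
      (auto intro: finadd_prob_le_1 dest: conditional_pairs_prob)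
  from cSUP_upper[OF assms(1) this] show ?thesis
    by (simp add: upper_natural_ext_def)
qed

text \<open>Conjugacy, from \<open>Q (\<Omega> - A) = 1 - Q A\<close> pair by pair. It reduces
  bounds on the upper extension to bounds on the lower one.\<close>

lemma lower_natural_ext_Compl:
  assumes ne: "conditional_pairs \<Omega> lP B \<noteq> {}" and A: "A \<subseteq> \<Omega>"
  shows "lower_natural_ext \<Omega> lP (\<Omega> - A) B = 1 - upper_natural_ext \<Omega> lP A B"
proof (rule antisym)
  have "upper_natural_ext \<Omega> lP A B \<le> 1 - lower_natural_ext \<Omega> lP (\<Omega> - A) B"
    unfolding upper_natural_ext_def
  proof (rule cSUP_least[OF ne], clarify)
    fix P Q assume "(P, Q) \<in> conditional_pairs \<Omega> lP B"
    from lower_natural_ext_lower[OF this, of "\<Omega> - A"]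
      finadd_prob_Compl[OF conditional_pairs_prob(1)[OF this] A]
    show "Q A \<le> 1 - lower_natural_ext \<Omega> lP (\<Omega> - A) B"
      by simp
  qed
  then show "lower_natural_ext \<Omega> lP (\<Omega> - A) B \<le> 1 - upper_natural_ext \<Omega> lP A B"
    by simp
next
  show "1 - upper_natural_ext \<Omega> lP A B \<le> lower_natural_ext \<Omega> lP (\<Omega> - A) B"
    unfolding lower_natural_ext_def
  proof (rule cINF_greatest[OF ne], clarify)
    fix P Q assume "(P, Q) \<in> conditional_pairs \<Omega> lP B"
    from upper_natural_ext_upper[OF this A]
      finadd_prob_Compl[OF conditional_pairs_prob(1)[OF this] A]
    show "1 - upper_natural_ext \<Omega> lP A B \<le> Q (\<Omega> - A)"
      by simp
  qed
qed

text \<open>Since \<open>Q B = 1\<close>, every pair gives \<open>Q A = 1\<close>. Used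
  contrapositively: a lower extension below 1 yields an atom in \<open>B - A\<close>.\<close>

lemma lower_natural_ext_superset_ge_1:
  assumes ne: "conditional_pairs \<Omega> lP B \<noteq> {}" and "B \<subseteq> A" "A \<subseteq> \<Omega>"
  shows "1 \<le> lower_natural_ext \<Omega> lP A B"
  unfolding lower_natural_ext_def
proof (rule cINF_greatest[OF ne], clarify)
  fix P Q assume "(P, Q) \<in> conditional_pairs \<Omega> lP B"
  from finadd_prob_mono[OF conditional_pairs_prob(1)[OF this] assms(2,3)]
    conditional_pairs_prob(2)[OF this]
  show "1 \<le> Q A"
    by simp
qed

section \<open>Extremal dominating probabilities\<close>

text \<open>Mass \<open>r\<close> is packed into \<open>X\<close> first, following \<open>P0\<close>
  proportionally; what exceeds \<open>b * P0 X\<close> goes to \<open>A - X\<close>, where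
  \<open>r \<le> b * P0 A\<close> leaves room. So \<open>R X\<close> is as large as the bound
  \<open>b * P0\<close> and the total mass \<open>r\<close> permit.\<close>

lemma extremal_submeasure:
  assumes P0: "finadd_prob \<Omega> P0" and "0 \<le> b" "0 \<le> r"
    and X: "X \<subseteq> A" "A \<subseteq> \<Omega>" and r: "r \<le> b * P0 A"
  obtains R :: "'a set \<Rightarrow> real"
  where "additive (Pow \<Omega>) R" "R \<Omega> = r" "\<And>E. E \<subseteq> \<Omega> \<Longrightarrow> 0 \<le> R E \<and> R E \<le> b * P0 E"
    "R X = min r (b * P0 X)"
proof -
  \<comment> \<open>Mass \<open>s\<close> spread over \<open>W\<close> in proportion to
    \<open>P0\<close> has density \<open>s / P0 W \<le> b\<close>. If \<open>P0 W = 0\<close>,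
    division by zero gives 0.\<close>
  have thin: "s * (P0 (E \<inter> W) / P0 W) \<le> b * P0 (E \<inter> W)"
    if "E \<subseteq> \<Omega>" "W \<subseteq> \<Omega>" "s \<le> b * P0 W" for s E W
  proof (cases "P0 W = 0")
    case True
    then show ?thesis
      using that assms(2) by (auto intro!: mult_nonneg_nonneg finadd_prob_nonneg[OF P0])
  next
    case False
    then have "0 < P0 W"
      using finadd_prob_nonneg[OF P0, of W] that by auto
    then have "s / P0 W \<le> b"
      using that by (simp add: divide_simps)
    then have "s / P0 W * P0 (E \<inter> W) \<le> b * P0 (E \<inter> W)"
      using that by (intro mult_right_mono finadd_prob_nonneg[OF P0]) auto
    then show ?thesis
      by simp
  qed
  have nonneg: "0 \<le> P0 (E \<inter> W)" "0 \<le> P0 W" if "W \<subseteq> \<Omega>" for E W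
    using that by (auto intro!: finadd_prob_nonneg[OF P0])
  \<comment> \<open>For \<open>P0 W = 0\<close> the bounds force \<open>s = 0\<close>, so the value
    0 of the quotient is still the right total.\<close>
  have mass: "s * (P0 (\<Omega> \<inter> W) / P0 W) = s" if "W \<subseteq> \<Omega>" "0 \<le> s" "s \<le> b * P0 W" for s W
    using that by (cases "P0 W = 0") (auto simp: Int_absorb1)
  have X\<Omega>: "X \<subseteq> \<Omega>" and W\<Omega>: "A - X \<subseteq> \<Omega>"
    using X by auto
  show ?thesis
  proof (cases "r \<le> b * P0 X")
    case True
    let ?R = "\<lambda>E. r * (P0 (E \<inter> X) / P0 X)"
    have "additive (Pow \<Omega>) ?R"
      using additive_restrict_prob[OF P0, of X]
      by (simp add: additive_def add_divide_distrib distrib_left)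
    moreover have "?R \<Omega> = r" "?R X = min r (b * P0 X)"
      using mass[OF X\<Omega> assms(3) True] True X\<Omega> by (auto simp: Int_absorb1)
    moreover have "0 \<le> ?R E \<and> ?R E \<le> b * P0 E" if "E \<subseteq> \<Omega>" for E
    proof -
      have "b * P0 (E \<inter> X) \<le> b * P0 E"
        using that assms(2) by (intro mult_left_mono finadd_prob_mono[OF P0]) auto
      then show ?thesis
        using thin[OF that X\<Omega> True] nonneg[OF X\<Omega>] assms(3) by auto
    qed
    ultimately show ?thesis
      using that[of ?R] by blast
  next
    case False
    define W where "W = A - X"
    \<comment> \<open>The mass left over once \<open>X\<close> is saturated by
      \<open>b * P0\<close>.\<close>
    define s where "s = r - b * P0 X"
    have W: "W \<subseteq> \<Omega>"
      using W\<Omega> by (simp add: W_def)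
    have "P0 A = P0 X + P0 W"
      using finadd_prob_split[OF P0 X(2), of X] X by (simp add: W_def Int_absorb1)
    then have s: "0 \<le> s" "s \<le> b * P0 W"
      using r False by (auto simp: s_def algebra_simps)
    let ?R = "\<lambda>E. b * P0 (E \<inter> X) + s * (P0 (E \<inter> W) / P0 W)"
    have "additive (Pow \<Omega>) ?R"
      using additive_restrict_prob[OF P0, of X] additive_restrict_prob[OF P0, of W]
      by (simp add: additive_def add_divide_distrib distrib_left)
    moreover have "?R \<Omega> = r"
      using mass[OF W s] X\<Omega> by (simp add: Int_absorb1 s_def)
    moreover have "?R X = min r (b * P0 X)"
    proof -
      have "X \<inter> W = {}"
        by (auto simp: W_def)
      then show ?thesis
        using False finadd_prob_empty[OF P0] by simp
    qed
    moreover have "0 \<le> ?R E \<and> ?R E \<le> b * P0 E" if E: "E \<subseteq> \<Omega>" for E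
    proof -
      have "P0 (E \<inter> X) + P0 (E \<inter> W) = P0 ((E \<inter> X) \<union> (E \<inter> W))"
        using E by (intro finadd_prob_Un[OF P0, symmetric]) (auto simp: W_def)
      also have "\<dots> \<le> P0 E"
        using E by (intro finadd_prob_mono[OF P0]) auto
      finally have "b * P0 (E \<inter> X) + b * P0 (E \<inter> W) \<le> b * P0 E"
        using assms(2) by (metis distrib_left mult_left_mono)
      then show ?thesis
        using thin[OF E W s(2)] nonneg[OF W] nonneg[OF X\<Omega>] assms(2) s(1) by auto
    qed
    ultimately show ?thesis
      using that[of ?R] by blast
  qed
qed

text \<open>The total mass is \<open>b + a + c = 1\<close>. The bound \<open>R \<le> b * P0\<close>
  gives nonnegativity, and \<open>R E \<le> R \<Omega> = -a\<close> gives the barrier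
  \<open>b * P0 E + a\<close>.\<close>

lemma dominating_prob_shift:
  assumes vbm: "vertical_barrier_model \<Omega> P0 a b c lP uP"
    and R: "additive (Pow \<Omega>) R" "R \<Omega> = -a" "\<And>E. E \<subseteq> \<Omega> \<Longrightarrow> 0 \<le> R E \<and> R E \<le> b * P0 E"
    and y: "y \<in> \<Omega>"
  shows "(\<lambda>E. b * P0 E - R E + c * indicator E y) \<in> dominating_probs \<Omega> lP" (is "?P \<in> _")
proof -
  have P0: "finadd_prob \<Omega> P0" and c: "c = 1 - (a + b)" "0 \<le> c"
    and lP: "\<And>E. E \<subseteq> \<Omega> \<Longrightarrow> lP E = (if E = \<Omega> then 1 else max (b * P0 E + a) 0)"
    using vbm by (auto simp: vertical_barrier_model_def)
  have nonneg: "0 \<le> ?P E" if "E \<subseteq> \<Omega>" for E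
    using R(3)[OF that] c(2) by (simp add: indicator_def)
  have total: "?P \<Omega> = 1"
    using R(2) y c finadd_prob_space[OF P0] by simp
  have "additive (Pow \<Omega>) ?P"
    unfolding additive_def
  proof (intro ballI impI)
    fix E F assume EF: "E \<in> Pow \<Omega>" "F \<in> Pow \<Omega>" "E \<inter> F = {}"
    then have "P0 (E \<union> F) = P0 E + P0 F" "R (E \<union> F) = R E + R F"
      using finadd_prob_Un[OF P0] R(1) by (auto simp: additive_def)
    moreover have "indicator (E \<union> F) y = (indicator E y + indicator F y :: real)"
      using EF by (auto simp: indicator_def)
    ultimately show "?P (E \<union> F) = ?P E + ?P F"
      by (simp add: algebra_simps)
  qed
  then have "finadd_prob \<Omega> ?P"
    using nonneg total by (auto simp: finadd_prob_def)
  moreover have "lP E \<le> ?P E" if E: "E \<subseteq> \<Omega>" for E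
  proof -
    have "R (E \<union> (\<Omega> - E)) = R E + R (\<Omega> - E)"
      using E by (intro additiveD[OF R(1)]) auto
    moreover have "E \<union> (\<Omega> - E) = \<Omega>"
      using E by auto
    ultimately have "R E \<le> - a"
      using R(2) R(3)[of "\<Omega> - E"] by auto
    moreover have "0 \<le> c * indicator E y"
      using c(2) by (simp add: indicator_def)
    ultimately show ?thesis
      using nonneg[OF E] total lP[OF E] by auto
  qed
  ultimately show ?thesis
    by (auto simp: dominating_probs_def)
qed

text \<open>Meant for \<open>X = A \<inter> B\<close> and \<open>Y = B - A\<close>: the removed mass
  \<open>R\<close> is concentrated on \<open>X\<close> and the added mass \<open>c\<close> sits at
  an atom \<open>y\<close> outside \<open>X\<close>. This makes \<open>X\<close> light and
  \<open>Y\<close> heavy simultaneously, so the conditional probability of \<open>A\<close> given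
  \<open>B\<close> is small.\<close>

lemma extremal_dominating_prob:
  assumes vbm: "vertical_barrier_model \<Omega> P0 a b c lP uP"
    and A: "A \<subseteq> \<Omega>" "0 \<le> b * P0 A + a" and X: "X \<subseteq> A" and y: "y \<in> \<Omega>" "y \<notin> X"
  obtains P where "P \<in> dominating_probs \<Omega> lP" "P X = max (b * P0 X + a) 0"
    "\<And>Y. Y \<subseteq> \<Omega> \<Longrightarrow> y \<in> Y \<Longrightarrow> X \<inter> Y = {} \<Longrightarrow> 0 \<le> b * P0 X + a \<Longrightarrow> P Y = b * P0 Y + c"
proof -
  have vb: "finadd_prob \<Omega> P0" "0 \<le> b" "0 \<le> - a"
    using vbm by (auto simp: vertical_barrier_model_def)
  have "- a \<le> b * P0 A"
    using A by simp
  then obtain R where R: "additive (Pow \<Omega>) R" "R \<Omega> = -a"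
      "\<And>E. E \<subseteq> \<Omega> \<Longrightarrow> 0 \<le> R E \<and> R E \<le> b * P0 E" and RX: "R X = min (-a) (b * P0 X)"
    using extremal_submeasure[OF vb X A(1)] by metis
  let ?P = "\<lambda>E. b * P0 E - R E + c * indicator E y"
  have "?P X = max (b * P0 X + a) 0"
    using RX y by auto
  moreover have "?P Y = b * P0 Y + c"
    if Y: "Y \<subseteq> \<Omega>" "y \<in> Y" "X \<inter> Y = {}" "0 \<le> b * P0 X + a" for Y
  proof -
    have "X \<subseteq> \<Omega>"
      using X A by auto
    then have "X \<union> Y \<subseteq> \<Omega>"
      using Y by simp
    with \<open>X \<subseteq> \<Omega>\<close> have "R (X \<union> Y) = R X + R Y"
      "R ((X \<union> Y) \<union> (\<Omega> - (X \<union> Y))) = R (X \<union> Y) + R (\<Omega> - (X \<union> Y))"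
      using Y additiveD[OF R(1), of X Y] additiveD[OF R(1), of "X \<union> Y" "\<Omega> - (X \<union> Y)"] by auto
    moreover have "(X \<union> Y) \<union> (\<Omega> - (X \<union> Y)) = \<Omega>"
      using \<open>X \<subseteq> \<Omega>\<close> Y by auto
    \<comment> \<open>As \<open>b * P0 X + a \<ge> 0\<close>, the minimum in \<open>RX\<close> is
      \<open>-a\<close>: \<open>X\<close> absorbs all of \<open>R\<close>, leaving nothing for the
      disjoint \<open>Y\<close>.\<close>
    ultimately have "R Y = 0"
      using R(2) R(3)[of Y] R(3)[of "\<Omega> - (X \<union> Y)"] RX Y by auto
    then show ?thesis
      using Y by simp
  qed
  ultimately show ?thesis
    using that[of ?P] dominating_prob_shift[OF vbm R y(1)] by blast
qed

section \<open>The lower extension in a Vertical Barrier Model\<close>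

lemma conditional_pairs_nonempty:
  assumes vbm: "vertical_barrier_model \<Omega> P0 a b c lP uP" and B: "B \<subseteq> \<Omega>" "0 < lP B" and y: "y \<in> \<Omega>"
  shows "conditional_pairs \<Omega> lP B \<noteq> {}"
proof -
  have vb: "finadd_prob \<Omega> P0" "0 \<le> a + b"
    using vbm by (auto simp: vertical_barrier_model_def)
  \<comment> \<open>Any dominating probability will do; the instance is \<open>A = \<Omega>\<close>,
    \<open>X = {}\<close>.\<close>
  then have "0 \<le> b * P0 \<Omega> + a"
    by (simp add: finadd_prob_space)
  then obtain P where P: "P \<in> dominating_probs \<Omega> lP"
    using extremal_dominating_prob[OF vbm, of \<Omega> "{}" y] y by blast
  then have "0 < P B"
    using B by (auto simp: dominating_probs_def intro: less_le_trans)
  from conditional_prob_in_conditional_pairs[OF P B(1) this] show ?thesis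
    by auto
qed

text \<open>The infimum is bounded by its value at one extremal dominating probability. The two
  strict bounds on the extension exclude the degenerate cases: below 1 supplies an atom of
  \<open>B - A\<close> to carry \<open>c\<close>, above 0 rules out the truncated value 0 on
  \<open>A \<inter> B\<close>.\<close>

lemma lower_natural_ext_vbm_le:
  assumes vbm: "vertical_barrier_model \<Omega> P0 a b c lP uP"
    and A: "A \<subseteq> \<Omega>" "0 \<le> b * P0 A + a" and B: "B \<subseteq> \<Omega>" "0 < lP B"
    and L: "0 < lower_natural_ext \<Omega> lP A B" "lower_natural_ext \<Omega> lP A B < 1"
  shows "lower_natural_ext \<Omega> lP A B \<le> (b * P0 (A \<inter> B) + a) / (b * P0 B + a + c)"
proof -
  have P0: "finadd_prob \<Omega> P0"
    using vbm by (auto simp: vertical_barrier_model_def)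
  then have "\<Omega> \<noteq> {}"
    using finadd_prob_empty finadd_prob_space by fastforce
  then have "\<not> B \<subseteq> A"
    using lower_natural_ext_superset_ge_1 conditional_pairs_nonempty[OF vbm B] A(1) L(2)
    by (metis all_not_in_conv not_le)
  then obtain y where y: "y \<in> B - A"
    by auto
  have X: "A \<inter> B \<subseteq> A" "y \<in> \<Omega>" "y \<notin> A \<inter> B"
    and Y: "B - A \<subseteq> \<Omega>" "y \<in> B - A" "(A \<inter> B) \<inter> (B - A) = {}"
    using y B(1) by auto
  obtain P where P: "P \<in> dominating_probs \<Omega> lP"
      "P (A \<inter> B) = max (b * P0 (A \<inter> B) + a) 0"
      "0 \<le> b * P0 (A \<inter> B) + a \<Longrightarrow> P (B - A) = b * P0 (B - A) + c"
    using extremal_dominating_prob[OF vbm A X] Y by metis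
  have fin: "finadd_prob \<Omega> P" and PB: "0 < P B"
    using P(1) B by (auto simp: dominating_probs_def intro: less_le_trans)
  have le: "lower_natural_ext \<Omega> lP A B \<le> P (A \<inter> B) / P B"
    using lower_natural_ext_lower[OF conditional_prob_in_conditional_pairs[OF P(1) B(1) PB] A(1)] .
  then have "0 < P (A \<inter> B)"
    using L(1) PB by (smt (verit) divide_nonpos_pos)
  \<comment> \<open>With the maximum positive, the conditional formula for \<open>P (B - A)\<close>
    becomes available.\<close>
  then have pos: "0 < b * P0 (A \<inter> B) + a"
    using P(2) by auto
  moreover have "P B = P (A \<inter> B) + P (B - A)" "P0 B = P0 (A \<inter> B) + P0 (B - A)"
    using finadd_prob_split[OF fin B(1), of A] finadd_prob_split[OF P0 B(1), of A]
    by (simp_all add: Int_commute)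
  ultimately have "P B = b * P0 B + a + c" "P (A \<inter> B) = b * P0 (A \<inter> B) + a"
    using P(2,3) by (auto simp: algebra_simps)
  then show ?thesis
    using le by simp
qed

theorem proposition5p4:
  fixes \<Omega> :: "'a set" and P0 lP uP :: "'a set \<Rightarrow> real" and a b c :: real
    and A :: "'a set" and \<B> :: "'a set set"
  assumes "vertical_barrier_model \<Omega> P0 a b c lP uP"
    and "b < 1"
    and "A \<in> Pow \<Omega>"
    and "lP A \<in> {0<..<1}" and "uP A \<in> {0<..<1}"
    and "partition_on \<Omega> \<B>"
    and "\<And>B. B \<in> \<B> \<Longrightarrow> 0 < lP B"
    and "\<And>B. B \<in> \<B> \<Longrightarrow> P0 B < 1"
    and "\<And>B. B \<in> \<B> \<Longrightarrow> lower_natural_ext \<Omega> lP A B \<in> {0<..<1}"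
    and "\<And>B. B \<in> \<B> \<Longrightarrow> upper_natural_ext \<Omega> lP A B \<in> {0<..<1}"
  shows "\<forall>B\<in>\<B>. imprecision_gain \<Omega> lP uP A B > 0"
proof
  fix B assume B: "B \<in> \<B>"
  note vbm = assms(1)
  have vb: "finadd_prob \<Omega> P0" "0 < b" "a \<le> 0" "c = 1 - (a + b)"
    using vbm by (auto simp: vertical_barrier_model_def)
  note P0 = vb(1)
  have A: "A \<subseteq> \<Omega>" and B\<Omega>: "B \<subseteq> \<Omega>"
    using assms(3,6) B by (auto simp: partition_on_def)
  have "lP A = (if A = \<Omega> then 1 else max (b * P0 A + a) 0)"
    "uP A = (if A = {} then 0 else min (b * P0 A + c) 1)"
    using vbm A by (auto simp: vertical_barrier_model_def)
  \<comment> \<open>Values strictly inside the unit interval exclude the exceptional events and both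
    truncations.\<close>
  then have lPA: "lP A = b * P0 A + a" "0 < b * P0 A + a"
    and uPA: "uP A = b * P0 A + c" "b * P0 A + c < 1"
    using assms(4,5) by (auto split: if_splits simp: max_def min_def)
  \<comment> \<open>\<open>uP A < 1\<close> reads \<open>b * P0 A + c < 1\<close>, which is
    \<open>b * P0 (\<Omega> - A) + a > 0\<close>: the complement also has room for the mass
    \<open>-a\<close>.\<close>
  then have compl: "0 \<le> b * P0 (\<Omega> - A) + a"
    unfolding finadd_prob_Compl[OF P0 A] using vb(4) by (simp add: algebra_simps)
  obtain y where "y \<in> \<Omega>"
    using finadd_prob_empty[OF P0] finadd_prob_space[OF P0] by fastforce
  note conj = lower_natural_ext_Compl[OF
      conditional_pairs_nonempty[OF vbm B\<Omega> assms(7)[OF B] this] A]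
  define D where "D = b * P0 B + a + c"
  \<comment> \<open>By the choice of \<open>c\<close>, \<open>D = 1 - b * (1 - P0 B)\<close>;
    \<open>P0 B < 1\<close> gives the upper bound and \<open>b < 1\<close> the lower.\<close>
  have D: "D < 1" "0 < D"
  proof -
    have "b * P0 B < b * 1"
      using assms(8)[OF B] vb(2) by (intro mult_strict_left_mono) auto
    then show "D < 1"
      by (simp add: D_def vb(4))
    show "0 < D"
      using assms(2) vb finadd_prob_nonneg[OF P0 B\<Omega>] by (simp add: D_def add_nonneg_pos)
  qed
  have lo: "lower_natural_ext \<Omega> lP A B \<le> (b * P0 (A \<inter> B) + a) / D"
    using lower_natural_ext_vbm_le[OF vbm A _ B\<Omega> assms(7)[OF B]] lPA assms(9)[OF B]
    by (auto simp: D_def)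
  \<comment> \<open>The same bound for the complement, turned by conjugacy into a lower bound on the
    upper extension.\<close>
  have "lower_natural_ext \<Omega> lP (\<Omega> - A) B \<le> (b * P0 ((\<Omega> - A) \<inter> B) + a) / D"
    using lower_natural_ext_vbm_le[OF vbm _ compl B\<Omega> assms(7)[OF B]] assms(10)[OF B] conj
    by (auto simp: D_def)
  moreover have "(\<Omega> - A) \<inter> B = B - A"
    using B\<Omega> by auto
  ultimately have up: "1 - (b * P0 (B - A) + a) / D \<le> upper_natural_ext \<Omega> lP A B"
    using conj by simp
  have "P0 B = P0 (A \<inter> B) + P0 (B - A)"
    using finadd_prob_split[OF P0 B\<Omega>, of A] by (simp add: Int_commute)
  then have "D - (b * P0 (B - A) + a) - (b * P0 (A \<inter> B) + a) = c - a"
    by (simp add: D_def algebra_simps)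
  then have "1 - (b * P0 (B - A) + a) / D - (b * P0 (A \<inter> B) + a) / D = (c - a) / D"
    using D(2) by (metis diff_divide_distrib divide_self less_irrefl)
  moreover have "c - a < (c - a) / D"
  proof -
    \<comment> \<open>\<open>c - a = (1 - b) - 2 * a\<close>, so \<open>b < 1\<close> makes it
      positive, and dividing by \<open>D < 1\<close> strictly increases it.\<close>
    have "0 < c - a"
      using vb assms(2) by simp
    then show ?thesis
      using D by (simp add: less_divide_eq)
  qed
  ultimately show "imprecision_gain \<Omega> lP uP A B > 0"
    using lo up lPA(1) uPA(1) by (simp add: imprecision_gain_def)
qed

end
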